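(* Let $E$ be a Polish space and, for every $N=1,2,3,\dots$, let $Y^N$ be a Feller process with càdlàg sample paths in $E$, defined on a probability space $(\Omega^N,\mathcal F^N,\mathbb P^N)$, and let $E^N\subset E$ be the support of $Y^N(0)$. Assume that: (i) for every $N$, the process $Y^N$ is reversible under some probability $\Pi^N$ on $E$ (with $\Pi^N(E^N)=1$); (ii) there is a space continuous semi-flow $\varphi$ on $E$ (the fluid limit) such that for every $y_0\in E$, every sequence $(y_0^N)_{N=1,2,\dots}$ with $y_0^N\in E^N$ for all $N$ and $\lim_{N\to\infty}y_0^N=y_0$, every $t\ge 0$ and every $h\in\mathcal C_b(E)$, $$\lim_{N\to\infty}\mathbb E^N\left[h(Y^N(t))\,\middle|\,Y^N(0)=y_0^N\right]=h(\varphi_t(y_0));$$ (iii) $\Pi$ is a probability on $E$ that is a limit point, for weak convergence, of the sequence $(\Pi^N)_{N\ge1}$. Then the fluid limit $\varphi$ is reversible under $\Pi$. In particular, $\Pi$ is concentrated on the set of stationary points of $\varphi$, i.e. $\Pi(S)=1$ where $S=\{y\in E:\ \varphi_t(y)=y\text{ for all }t\ge 0\}$.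
   Context: $\mathcal C_b(E)$ and $\mathcal C_b(E\times E)$ are the sets of bounded continuous real-valued functions on $E$ and $E\times E$. Time is continuous, $t\in[0,\infty)$; $Y^N(t)$ is the value of $Y^N$ at time $t$. $E^N$ is the support of $Y^N(0)$, so that $\mathbb P^N(Y^N(0)\in E^N)=1$. The processes $Y^N$ are not required to be Markov. The conditional expectations $\mathbb E^N[\,\cdot\,|Y^N(0)=y]$ are expectations under the conditional law of $Y^N$ given the initial condition $Y^N(0)=y$. "Feller" means: for every $t\ge 0$ and $h\in\mathcal C_b(E)$, $\mathbb E^N[h(Y^N(t))\,|\,Y^N(0)=y_0]$ is a continuous function of $y_0\in E$. Reversible process: given a probability $\Pi^N$ on $E$ with $\Pi^N(E^N)=1$, $Y^N$ is reversible under $\Pi^N$ if for every $t\ge 0$ and every $h\in\mathcal C_b(E\times E)$, $$\int_E\mathbb E^N\left[h(y,Y^N(t))\,\middle|\,Y^N(0)=y\right]\Pi^N(dy)=\int_E\mathbb E^N\left[h(Y^N(t),y)\,\middle|\,Y^N(0)=y\right]\Pi^N(dy).$$ Semi-flow: a measurable mapping $\varphi:[0,\infty)\times E\to E$, $(t,y)\mapsto\varphi_t(y)$, with $\varphi_0(y)=y$ and $\varphi_{s+t}=\varphi_s\circ\varphi_t$ for all $s,t\ge0$; it is space continuous if $y\mapsto\varphi_t(y)$ is continuous for every $t\ge 0$. The semi-flow $\varphi$ is reversible under a probability $\Pi$ on $E$ if for every $t\ge0$ and every $h\in\mathcal C_b(E\times E)$, $\int_E h(y,\varphi_t(y))\,\Pi(dy)=\int_E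 h(\varphi_t(y),y)\,\Pi(dy)$.
   Formalization: Assumption (ii) is required also along subsequences of indices (initial points in E^{N_k} for any increasing N_k); with sequences over all N only, the claim fails, e.g. Y^N constantly 0 for N even and 1 for N odd, with φ_t(y)=e^{-t}y and Π=δ_1. *)

theory Defs
  imports "HOL-Probability.Probability"
begin

text \<open>
  Time is the half-line \<open>{0..}\<close> of \<^typ>\<open>real\<close>; values at negative times are never used.
  \<open>bcontfun\<close> is the set of bounded continuous functions.
\<close>

definition cadlag :: "(real \<Rightarrow> 'a::topological_space) \<Rightarrow> bool" where
  "cadlag x \<longleftrightarrow>
     (\<forall>t\<ge>0. (x \<longlongrightarrow> x t) (at_right t)) \<and>
     (\<forall>t>0. \<exists>l. (x \<longlongrightarrow> l) (at_left t))"

text \<open>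
  The space of cadlag paths with the \<open>\<sigma>\<close>-algebra generated by the evaluation maps (for a Polish
  state space this is the Borel \<open>\<sigma>\<close>-algebra of the Skorokhod topology). Paths are
  \<open>undefined\<close> at negative times, as elements of \<open>PiM {0..} _\<close>.
\<close>

definition path_space :: "(real \<Rightarrow> 'a::topological_space) measure" where
  "path_space = restrict_space (PiM {0..} (\<lambda>_. borel)) {x. cadlag x}"

definition sample_path :: "(real \<Rightarrow> 'w \<Rightarrow> 'a) \<Rightarrow> 'w \<Rightarrow> real \<Rightarrow> 'a" where
  "sample_path Y \<omega> = (\<lambda>t\<in>{0..}. Y t \<omega>)"

definition cadlag_process :: "'w measure \<Rightarrow> (real \<Rightarrow> 'w \<Rightarrow> 'a::topological_space) \<Rightarrow> bool" where
  "cadlag_process P Y \<longleftrightarrow>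
     prob_space P \<and>
     (\<forall>t\<ge>0. Y t \<in> borel_measurable P) \<and>
     (\<forall>\<omega>\<in>space P. cadlag (\<lambda>t. Y t \<omega>))"

text \<open>
  \<open>\<kappa> y\<close> is the conditional law of the whole path of \<open>Y\<close> given \<open>Y 0 = y\<close>: \<open>\<kappa>\<close> is a regular
  conditional distribution of the path given the initial value.
\<close>

definition initial_cond_law ::
  "'w measure \<Rightarrow> (real \<Rightarrow> 'w \<Rightarrow> 'a::topological_space) \<Rightarrow> ('a \<Rightarrow> (real \<Rightarrow> 'a) measure) \<Rightarrow> bool" where
  "initial_cond_law P Y \<kappa> \<longleftrightarrow>
     \<kappa> \<in> borel \<rightarrow>\<^sub>M prob_algebra path_space \<and>
     (\<forall>A\<in>sets borel. \<forall>B\<in>sets path_space.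
        emeasure P {\<omega> \<in> space P. Y 0 \<omega> \<in> A \<and> sample_path Y \<omega> \<in> B} =
        (\<integral>\<^sup>+ y\<in>A. emeasure (\<kappa> y) B \<partial>distr P borel (Y 0)))"

text \<open>
  A regular conditional distribution is determined only up to null sets of the law of \<open>Y 0\<close>. The
  Feller property is a property of the chosen version; it determines the expectations below
  uniquely on the support of \<open>Y 0\<close>.
\<close>

definition feller :: "('a::topological_space \<Rightarrow> (real \<Rightarrow> 'a) measure) \<Rightarrow> bool" where
  "feller \<kappa> \<longleftrightarrow>
     (\<forall>t\<ge>0. \<forall>h \<in> (bcontfun :: ('a \<Rightarrow> real) set).
        continuous_on UNIV (\<lambda>y. \<integral>x. h (x t) \<partial>\<kappa> y))"

definition law_support :: "'w measure \<Rightarrow> ('w \<Rightarrow> 'a::topological_space) \<Rightarrow> 'a set" where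
  "law_support P X = {y. \<forall>U. open U \<longrightarrow> y \<in> U \<longrightarrow> emeasure (distr P borel X) U > 0}"

definition process_reversible ::
  "('a::topological_space \<Rightarrow> (real \<Rightarrow> 'a) measure) \<Rightarrow> 'a measure \<Rightarrow> bool" where
  "process_reversible \<kappa> M \<longleftrightarrow>
     (\<forall>t\<ge>0. \<forall>h \<in> (bcontfun :: ('a \<times> 'a \<Rightarrow> real) set).
        (\<integral>y. (\<integral>x. h (y, x t) \<partial>\<kappa> y) \<partial>M) = (\<integral>y. (\<integral>x. h (x t, y) \<partial>\<kappa> y) \<partial>M))"

definition semiflow :: "(real \<Rightarrow> 'a::topological_space \<Rightarrow> 'a) \<Rightarrow> bool" where
  "semiflow \<phi> \<longleftrightarrow>
     (\<lambda>(t, y). \<phi> t y) \<in> restrict_space borel {0..} \<Otimes>\<^sub>M borel \<rightarrow>\<^sub>M borel \<and>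
     (\<forall>y. \<phi> 0 y = y) \<and>
     (\<forall>s\<ge>0. \<forall>t\<ge>0. \<phi> (s + t) = \<phi> s \<circ> \<phi> t)"

definition space_continuous :: "(real \<Rightarrow> 'a::topological_space \<Rightarrow> 'a) \<Rightarrow> bool" where
  "space_continuous \<phi> \<longleftrightarrow> (\<forall>t\<ge>0. continuous_on UNIV (\<phi> t))"

definition semiflow_reversible ::
  "(real \<Rightarrow> 'a::topological_space \<Rightarrow> 'a) \<Rightarrow> 'a measure \<Rightarrow> bool" where
  "semiflow_reversible \<phi> M \<longleftrightarrow>
     (\<forall>t\<ge>0. \<forall>h \<in> (bcontfun :: ('a \<times> 'a \<Rightarrow> real) set).
        (\<integral>y. h (y, \<phi> t y) \<partial>M) = (\<integral>y. h (\<phi> t y, y) \<partial>M))"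

definition stationary_points :: "(real \<Rightarrow> 'a \<Rightarrow> 'a) \<Rightarrow> 'a set" where
  "stationary_points \<phi> = {y. \<forall>t\<ge>0. \<phi> t y = y}"

text \<open>
  Initial points converge and lie in the supports \<open>S N\<close> along some increasing sequence
  \<open>r 0 < r 1 < \<dots>\<close> of indices; \<open>r = Suc\<close> is the case of a sequence indexed by all \<open>N \<ge> 1\<close>.
  Subsequences are included because a point may be a limit of points of \<open>S N\<close> for
  infinitely many \<open>N\<close> without being a limit of points of \<open>S N\<close> for all \<open>N\<close>, and the measures
  in \<open>weak_limit_point\<close> converge only along a subsequence. With \<open>r = Suc\<close> alone, the
  conclusion fails for the time-constant processes \<open>Y N = 0\<close> (\<open>N\<close> even), \<open>Y N = 1\<close> (\<open>N\<close> odd) and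
  \<open>\<phi> t y = exp (- t) * y\<close> on the real line.
\<close>

definition fluid_limit ::
  "(nat \<Rightarrow> 'a::topological_space \<Rightarrow> (real \<Rightarrow> 'a) measure) \<Rightarrow> (nat \<Rightarrow> 'a set) \<Rightarrow>
     (real \<Rightarrow> 'a \<Rightarrow> 'a) \<Rightarrow> bool" where
  "fluid_limit \<kappa> S \<phi> \<longleftrightarrow>
     (\<forall>r :: nat \<Rightarrow> nat. \<forall>y y0. strict_mono r \<longrightarrow> (\<forall>k. r k \<ge> 1) \<longrightarrow>
        (\<forall>k. y k \<in> S (r k)) \<longrightarrow> y \<longlonglongrightarrow> y0 \<longrightarrow>
        (\<forall>t\<ge>0. \<forall>h \<in> (bcontfun :: ('a \<Rightarrow> real) set).
           (\<lambda>k. \<integral>x. h (x t) \<partial>\<kappa> (r k) (y k)) \<longlonglongrightarrow> h (\<phi> t y0)))"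

definition weakly_converges ::
  "(nat \<Rightarrow> 'a::topological_space measure) \<Rightarrow> 'a measure \<Rightarrow> bool" where
  "weakly_converges \<mu> M \<longleftrightarrow>
     (\<forall>h \<in> (bcontfun :: ('a \<Rightarrow> real) set). (\<lambda>k. \<integral>y. h y \<partial>\<mu> k) \<longlonglongrightarrow> (\<integral>y. h y \<partial>M))"

definition weak_limit_point ::
  "(nat \<Rightarrow> 'a::topological_space measure) \<Rightarrow> 'a measure \<Rightarrow> bool" where
  "weak_limit_point \<mu> M \<longleftrightarrow>
     (\<exists>r :: nat \<Rightarrow> nat. strict_mono r \<and> (\<forall>k. r k \<ge> 1) \<and> weakly_converges (\<mu> \<circ> r) M)"

end

theory Submission
  imports Defs
begin

text \<open>
  Fix a time \<open>t\<close>, a bounded continuous \<open>h\<close> on pairs of states, and a sequence of indices along which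
  the reversing measures \<open>\<mu>\<close> converge weakly to \<open>\<nu>\<close>. Put \<open>F\<^sub>n(y) = E[h(y, Y\<^sub>t) | Y\<^sub>0 = y]\<close> for the
  \<open>n\<close>-th process of the sequence.

  The fluid limit says that the law of \<open>Y\<^sub>t\<close> started at \<open>y\<^sub>n\<close> converges to the point mass at
  \<open>\<phi>\<^sub>t(y)\<close> whenever the \<open>y\<^sub>n\<close> lie in the supports and converge to \<open>y\<close>. Since the limit law is a
  point mass, the first argument of \<open>h\<close> may converge at the same time
  (\<open>deterministic_limit_joint\<close>), so \<open>F\<^sub>n(y\<^sub>n) \<longlonglongrightarrow> h(y, \<phi>\<^sub>t(y))\<close>. This continuous convergence suffices
  to integrate against the weakly converging measures (\<open>integral_continuous_convergence\<close>):
  \<open>\<integral>F\<^sub>n d\<mu>\<^sub>n \<longlonglongrightarrow> \<integral>h(y, \<phi>\<^sub>t(y)) \<nu>(dy)\<close>. The reason is that all \<open>F\<^sub>n\<close> from some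
  index on have, on the supports, a common bounded Lipschitz minorant, whose integrals do converge, and as the index
  grows these minorants come arbitrarily close to the limit function; negating \<open>F\<^sub>n\<close> gives the bound
  from above. Applied to \<open>h\<close> and to \<open>h\<close> with its
  arguments exchanged, this turns the reversibility of the processes into that of the semi-flow.

  For the second claim, test the reversibility of \<open>\<phi>\<close> at time \<open>s\<close> with the truncated distance between
  the first argument and the image under \<open>\<phi>\<^sub>s\<close> of the second. On one side it vanishes, on the other
  it compares \<open>y\<close> with \<open>\<phi>\<^sub>2\<^sub>s(y)\<close>. So for each single time \<open>t\<close> almost every \<open>y\<close> is fixed by \<open>\<phi>\<^sub>t\<close>.
  The flow is only measurable in time, so being fixed at rational times does not settle
  the other times. Instead, by Fubini, almost every \<open>y\<close> is fixed at Lebesgue almost every time, and the semigroup law upgrades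
  this to every time (\<open>stationary_points_iff_AE\<close>).
\<close>

section \<open>Integrals of continuously converging functions\<close>

lemma bounded_continuous_integrable:
  fixes h :: "'b::topological_space \<Rightarrow> real"
  assumes "prob_space M" and "sets M = sets borel" and "h \<in> bcontfun"
  shows "integrable M h"
proof -
  interpret prob_space M by fact
  obtain B where "\<And>x. norm (h x) \<le> B"
    using assms(3) unfolding bcontfun_def bounded_iff by auto
  moreover have "h \<in> borel_measurable M"
    using assms(2,3) borel_measurable_continuous_onI[of h] measurable_cong_sets[of M borel]
    unfolding bcontfun_def by auto
  ultimately show ?thesis
    by (intro integrable_const_bound[of h B]) auto
qed

lemma bcontfunI_abs:
  fixes h :: "'b::topological_space \<Rightarrow> real"
  assumes "continuous_on UNIV h" and "\<And>x. \<bar>h x\<bar> \<le> B"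
  shows "h \<in> bcontfun"
  using assms unfolding bcontfun_def bounded_iff by auto

text \<open>
  The inf-convolution of the whole tail \<open>F k, F (k + 1), \<dots>\<close>, each function seen only on its own set
  \<open>S n\<close>, with \<open>k + 1\<close> times the distance. Taking the infimum over the tail makes a single continuous
  function a lower bound of all \<open>F n\<close> with \<open>n \<ge> k\<close> at once, although the \<open>F n\<close> may converge only
  along points of the \<open>S n\<close>. The slope \<open>k + 1\<close> is positive for every \<open>k\<close> and tends to infinity, which
  forces near-minimisers towards \<open>y\<close>.
\<close>

definition lipschitz_minorant ::
  "(nat \<Rightarrow> 'a::metric_space \<Rightarrow> real) \<Rightarrow> (nat \<Rightarrow> 'a set) \<Rightarrow> nat \<Rightarrow> 'a \<Rightarrow> real" where
  "lipschitz_minorant F S k y =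
     (INF p\<in>{(n, z). n \<ge> k \<and> z \<in> S n}. F (fst p) (snd p) + real (Suc k) * dist y (snd p))"

context
  fixes F :: "nat \<Rightarrow> 'a::metric_space \<Rightarrow> real" and S :: "nat \<Rightarrow> 'a set" and C :: real
  assumes F_bound: "\<And>n y. \<bar>F n y\<bar> \<le> C" and S_ne: "\<And>n. S n \<noteq> {}"
begin

lemma minorant_term_ge: "-C \<le> F (fst p) (snd p) + real (Suc k) * dist y (snd p)"
proof -
  have "0 \<le> real (Suc k) * dist y (snd p)" by simp
  then show ?thesis using F_bound[of "fst p" "snd p"] by linarith
qed

lemma minorant_bdd_below:
  "bdd_below ((\<lambda>p. F (fst p) (snd p) + real (Suc k) * dist y (snd p)) ` A)"
  using minorant_term_ge by (rule bdd_belowI2)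

lemma minorant_index_nonempty: "{(n, z). n \<ge> k \<and> z \<in> S n} \<noteq> {}"
  using S_ne[of k] by auto

lemma lipschitz_minorant_le:
  assumes "k \<le> n" and "z \<in> S n"
  shows "lipschitz_minorant F S k y \<le> F n z + real (Suc k) * dist y z"
  unfolding lipschitz_minorant_def
  using assms by (intro cINF_lower2[OF minorant_bdd_below, of "(n, z)"]) auto

lemma lipschitz_minorant_ge: "-C \<le> lipschitz_minorant F S k y"
  unfolding lipschitz_minorant_def
  using minorant_index_nonempty minorant_term_ge by (rule cINF_greatest)

lemma lipschitz_minorant_diff:
  "lipschitz_minorant F S k x \<le> lipschitz_minorant F S k y + real (Suc k) * dist x y"
proof -
  have "lipschitz_minorant F S k x - real (Suc k) * dist x y \<le> lipschitz_minorant F S k y"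
    unfolding lipschitz_minorant_def[of F S k y]
  proof (rule cINF_greatest[OF minorant_index_nonempty])
    fix p assume "p \<in> {(n, z). n \<ge> k \<and> z \<in> S n}"
    then have "lipschitz_minorant F S k x \<le> F (fst p) (snd p) + real (Suc k) * dist x (snd p)"
      using lipschitz_minorant_le[of k "fst p" "snd p" x] by (simp add: case_prod_beta)
    also have "\<dots> \<le> F (fst p) (snd p) + real (Suc k) * (dist x y + dist y (snd p))"
      by (intro add_left_mono mult_left_mono dist_triangle) auto
    finally show "lipschitz_minorant F S k x - real (Suc k) * dist x y
        \<le> F (fst p) (snd p) + real (Suc k) * dist y (snd p)"
      by (simp add: distrib_left)
  qed
  then show ?thesis by simp
qed

lemma continuous_lipschitz_minorant: "continuous_on UNIV (lipschitz_minorant F S k)"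
proof -
  have "(real (Suc k))-lipschitz_on UNIV (lipschitz_minorant F S k)"
  proof (rule lipschitz_onI)
    fix x y
    show "dist (lipschitz_minorant F S k x) (lipschitz_minorant F S k y) \<le> real (Suc k) * dist x y"
      using lipschitz_minorant_diff[of k x y] lipschitz_minorant_diff[of k y x]
      by (simp add: dist_real_def dist_commute abs_le_iff)
  qed simp
  then show ?thesis by (rule lipschitz_on_continuous_on)
qed

text \<open>
  If the minorants stayed below the limit \<open>L\<close>, near-minimisers would exist arbitrarily far along the
  sequence. Boundedness of \<open>F\<close> bounds the penalty term by \<open>2 C\<close>, so these points converge to \<open>y0\<close>;
  along them \<open>F\<close> would have a limit below \<open>L\<close>. At a point that is no limit of points of the \<open>S n\<close> the same
  argument shows that the minorants exceed every \<open>L \<le> C\<close>, up to \<open>e\<close>.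
\<close>

lemma lipschitz_minorant_eventually_gt:
  assumes conv: "\<And>s y. strict_mono s \<Longrightarrow> (\<And>k. y k \<in> S (s k)) \<Longrightarrow> y \<longlonglongrightarrow> y0 \<Longrightarrow>
      (\<lambda>k. F (s k) (y k)) \<longlonglongrightarrow> L"
    and L: "L \<le> C" and e: "0 < e"
  shows "\<forall>\<^sub>F k in sequentially. L - e < lipschitz_minorant F S k y0"
proof (rule ccontr)
  assume "\<not> ?thesis"
  then have low: "\<exists>k\<ge>m. lipschitz_minorant F S k y0 \<le> L - e" for m
    unfolding eventually_sequentially by (meson not_less)
  define Q where "Q m p \<longleftrightarrow> snd p \<in> S (fst p) \<and> m \<le> fst p \<and> F (fst p) (snd p) < L - e / 2
      \<and> dist y0 (snd p) \<le> 2 * C / real (Suc m)" for m and p :: "nat \<times> 'a"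
  have C: "0 \<le> C" using F_bound[of 0 y0] by linarith
  have ex: "\<exists>p. Q m p" for m
  proof -
    obtain k where k: "m \<le> k" "lipschitz_minorant F S k y0 \<le> L - e" using low by blast
    then have "lipschitz_minorant F S k y0 < L - e / 2" using e by linarith
    then obtain p where p: "k \<le> fst p" "snd p \<in> S (fst p)"
        "F (fst p) (snd p) + real (Suc k) * dist y0 (snd p) < L - e / 2"
      unfolding lipschitz_minorant_def
      using cINF_less_iff[OF minorant_index_nonempty minorant_bdd_below] by fastforce
    have "real (Suc m) * dist y0 (snd p) \<le> real (Suc k) * dist y0 (snd p)"
      using k(1) by (intro mult_right_mono) auto
    also have "\<dots> \<le> 2 * C"
      using p(3) L e F_bound[of "fst p" "snd p"] by linarith
    finally have "dist y0 (snd p) \<le> 2 * C / real (Suc m)"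
      by (simp add: pos_le_divide_eq mult.commute)
    moreover have "0 \<le> real (Suc k) * dist y0 (snd p)" by simp
    then have "F (fst p) (snd p) < L - e / 2" using p(3) by linarith
    ultimately show ?thesis unfolding Q_def using p k by (intro exI[of _ p]) auto
  qed
  have Q_mono: "Q m p" if "Q m' p" "m \<le> m'" for m m' p
  proof -
    have "2 * C / real (Suc m') \<le> 2 * C / real (Suc m)"
      using that C by (intro divide_left_mono) auto
    then show ?thesis using that unfolding Q_def by auto
  qed
  \<comment> \<open>The convergence hypothesis speaks of strictly increasing index sequences, so the
    near-minimisers are chosen one after the other with increasing indices.\<close>
  have "\<exists>f. \<forall>i. Q i (f i) \<and> fst (f i) < fst (f (Suc i))"
  proof (rule dependent_nat_choice)
    show "\<exists>p. Q 0 p" by (rule ex)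
    fix p i
    obtain q where q: "Q (max (Suc i) (Suc (fst p))) q" using ex by blast
    then have "Q (Suc i) q" by (rule Q_mono) simp
    moreover have "fst p < fst q" using q unfolding Q_def by linarith
    ultimately show "\<exists>q. Q (Suc i) q \<and> fst p < fst q" by blast
  qed
  then obtain f where f: "\<And>i. Q i (f i)" "\<And>i. fst (f i) < fst (f (Suc i))" by blast
  have "(\<lambda>i. dist (snd (f i)) y0) \<longlonglongrightarrow> 0"
  proof (rule tendsto_sandwich[OF _ _ tendsto_const])
    show "(\<lambda>i. 2 * C / real (Suc i)) \<longlonglongrightarrow> 0"
      using LIMSEQ_Suc[OF lim_const_over_n[of "2 * C"]] by simp
  qed (use f(1) in \<open>auto simp: Q_def dist_commute\<close>)
  then have "(\<lambda>i. snd (f i)) \<longlonglongrightarrow> y0" by (simp flip: tendsto_dist_iff)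
  then have "(\<lambda>i. F (fst (f i)) (snd (f i))) \<longlonglongrightarrow> L"
    using f by (intro conv) (auto simp: strict_mono_Suc_iff Q_def)
  then have "L \<le> L - e / 2"
    using f(1) by (intro LIMSEQ_le_const2) (auto simp: Q_def intro!: less_imp_le)
  then show False using e by simp
qed

end

text \<open>
  One half of the convergence theorem below: a minorant is bounded and continuous, so its integrals
  pass to the weak limit, where it can be taken arbitrarily close to \<open>G\<close> by dominated convergence.
\<close>

lemma integral_continuous_convergence_lower:
  fixes F :: "nat \<Rightarrow> 'a::metric_space \<Rightarrow> real"
  assumes prob: "\<And>n. prob_space (M n)" and sets: "\<And>n. sets (M n) = sets borel"
    and carried: "\<And>n. AE y in M n. y \<in> S n"
    and nu: "prob_space \<nu>" "sets \<nu> = sets borel" and weak: "weakly_converges M \<nu>"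
    and F_meas: "\<And>n. F n \<in> borel_measurable borel" and F_bound: "\<And>n y. \<bar>F n y\<bar> \<le> C"
    and G_meas: "G \<in> borel_measurable borel" and G_bound: "\<And>y. \<bar>G y\<bar> \<le> C"
    and conv: "\<And>s y y0. strict_mono s \<Longrightarrow> (\<And>k. y k \<in> S (s k)) \<Longrightarrow> y \<longlonglongrightarrow> y0 \<Longrightarrow>
      (\<lambda>k. F (s k) (y k)) \<longlonglongrightarrow> G y0"
    and e: "0 < e"
  shows "\<forall>\<^sub>F n in sequentially. (\<integral>y. G y \<partial>\<nu>) - e < (\<integral>y. F n y \<partial>M n)"
proof -
  interpret nu: prob_space \<nu> by fact
  have S_ne: "S n \<noteq> {}" for n
  proof
    assume "S n = {}"
    then have "AE y in M n. False" using carried[of n] by simp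
    then show False using prob_space.AE_False[OF prob] by blast
  qed
  note min_le = lipschitz_minorant_le[of F C S, OF F_bound S_ne]
    and min_ge = lipschitz_minorant_ge[of F C S, OF F_bound S_ne]
    and min_cont = continuous_lipschitz_minorant[of F C S, OF F_bound S_ne]
    and min_gt = lipschitz_minorant_eventually_gt[of F C S, OF F_bound S_ne]
  \<comment> \<open>Far away from all the \<open>S n\<close> the minorants grow linearly; truncating at \<open>C\<close>
    makes them bounded, and as \<open>F n \<le> C\<close> nothing is lost on the \<open>S n\<close>.\<close>
  define g where "g k y = min C (lipschitz_minorant F S k y)" for k y
  have C: "0 \<le> C" using F_bound[of 0 undefined] by linarith
  have g_bound: "\<bar>g k y\<bar> \<le> C" for k y
    using min_ge[of k y] C unfolding g_def by (auto simp: abs_le_iff min_def)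
  have g_bcont: "g k \<in> bcontfun" for k
    using g_bound min_cont unfolding g_def[abs_def]
    by (intro bcontfunI_abs[of _ C] continuous_intros) auto
  have g_gt: "\<forall>\<^sub>F k in sequentially. G y - d < g k y" if "0 < d" for d y
  proof -
    have Gy: "G y \<le> C" using G_bound[of y] by linarith
    have "\<forall>\<^sub>F k in sequentially. G y - d < lipschitz_minorant F S k y"
      using conv Gy that by (rule min_gt)
    then show ?thesis
      by eventually_elim (use Gy that in \<open>simp add: g_def\<close>)
  qed
  have [measurable]: "G \<in> borel_measurable \<nu>" "g k \<in> borel_measurable \<nu>" for k
    using G_meas g_bcont[of k] borel_measurable_continuous_onI[of "g k"] nu(2)
      measurable_cong_sets[of \<nu> borel] unfolding bcontfun_def by auto
  \<comment> \<open>The \<open>g k\<close> may exceed \<open>G\<close> where no points of the \<open>S n\<close> accumulate; cutting them off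
    at \<open>G\<close> gives pointwise convergence to \<open>G\<close> everywhere.\<close>
  have "(\<lambda>k. \<integral>y. min (G y) (g k y) \<partial>\<nu>) \<longlonglongrightarrow> (\<integral>y. G y \<partial>\<nu>)"
  proof (rule integral_dominated_convergence[where w = "\<lambda>_. C"])
    show "AE y in \<nu>. (\<lambda>k. min (G y) (g k y)) \<longlonglongrightarrow> G y"
    proof (intro AE_I2 order_tendstoI)
      fix y a assume "a < G y"
      then show "\<forall>\<^sub>F k in sequentially. a < min (G y) (g k y)"
        using g_gt[of "G y - a" y] by (auto elim: eventually_mono)
    qed (auto intro: always_eventually)
    show "AE y in \<nu>. norm (min (G y) (g k y)) \<le> C" for k
      using G_bound g_bound[of k] by (auto simp: min_def)
  qed auto
  then have "\<forall>\<^sub>F k in sequentially. (\<integral>y. G y \<partial>\<nu>) - e < (\<integral>y. min (G y) (g k y) \<partial>\<nu>)"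
    using e by (intro order_tendstoD(1)) auto
  then obtain k where "(\<integral>y. G y \<partial>\<nu>) - e < (\<integral>y. min (G y) (g k y) \<partial>\<nu>)"
    unfolding eventually_sequentially by blast
  also have "\<dots> \<le> (\<integral>y. g k y \<partial>\<nu>)"
  proof (rule integral_mono)
    show "integrable \<nu> (\<lambda>y. min (G y) (g k y))"
      using G_bound g_bound[of k] by (intro nu.integrable_const_bound[of _ C]) (auto simp: min_def)
    show "integrable \<nu> (g k)"
      using nu g_bcont by (rule bounded_continuous_integrable)
  qed auto
  finally have "\<forall>\<^sub>F n in sequentially. (\<integral>y. G y \<partial>\<nu>) - e < (\<integral>y. g k y \<partial>M n)"
    using weak g_bcont unfolding weakly_converges_def by (intro order_tendstoD(1)) auto
  then show ?thesis
    using eventually_ge_at_top[of k]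
  proof eventually_elim
    case (elim n)
    interpret prob_space "M n" by (rule prob)
    have "(\<integral>y. g k y \<partial>M n) \<le> (\<integral>y. F n y \<partial>M n)"
    proof (rule integral_mono_AE)
      show "integrable (M n) (g k)"
        using prob sets g_bcont by (rule bounded_continuous_integrable)
      show "integrable (M n) (F n)"
        using F_bound F_meas[of n] unfolding measurable_cong_sets[OF sets[of n] refl, symmetric]
        by (intro integrable_const_bound[of _ C]) auto
      show "AE y in M n. g k y \<le> F n y"
        using carried[of n]
      proof eventually_elim
        fix y assume "y \<in> S n"
        then show "g k y \<le> F n y" using min_le[OF elim(2), of y y] unfolding g_def by simp
      qed
    qed
    with elim(1) show ?case by simp
  qed
qed

text \<open>
  An extended continuous mapping theorem: the functions vary with the measures, and they are
  controlled only along sequences in the sets \<open>S n\<close> that carry the measures. The hypotheses are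
  invariant under negation of \<open>F\<close> and \<open>G\<close>, so the lower bound yields the upper one.
\<close>

theorem integral_continuous_convergence:
  fixes F :: "nat \<Rightarrow> 'a::metric_space \<Rightarrow> real"
  assumes prob: "\<And>n. prob_space (M n)" and sets: "\<And>n. sets (M n) = sets borel"
    and carried: "\<And>n. AE y in M n. y \<in> S n"
    and nu: "prob_space \<nu>" "sets \<nu> = sets borel" and weak: "weakly_converges M \<nu>"
    and F_meas: "\<And>n. F n \<in> borel_measurable borel" and F_bound: "\<And>n y. \<bar>F n y\<bar> \<le> C"
    and G_meas: "G \<in> borel_measurable borel" and G_bound: "\<And>y. \<bar>G y\<bar> \<le> C"
    and conv: "\<And>s y y0. strict_mono s \<Longrightarrow> (\<And>k. y k \<in> S (s k)) \<Longrightarrow> y \<longlonglongrightarrow> y0 \<Longrightarrow>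
      (\<lambda>k. F (s k) (y k)) \<longlonglongrightarrow> G y0"
  shows "(\<lambda>n. \<integral>y. F n y \<partial>M n) \<longlonglongrightarrow> (\<integral>y. G y \<partial>\<nu>)"
proof (rule order_tendstoI)
  fix a assume "a < (\<integral>y. G y \<partial>\<nu>)"
  then have pos: "0 < (\<integral>y. G y \<partial>\<nu>) - a" by simp
  have "\<forall>\<^sub>F n in sequentially. (\<integral>y. G y \<partial>\<nu>) - ((\<integral>y. G y \<partial>\<nu>) - a) < (\<integral>y. F n y \<partial>M n)"
    by (rule integral_continuous_convergence_lower[OF prob sets carried nu weak
          F_meas F_bound G_meas G_bound _ pos]) (rule conv)
  then show "\<forall>\<^sub>F n in sequentially. a < (\<integral>y. F n y \<partial>M n)" by simp
next
  fix a assume "(\<integral>y. G y \<partial>\<nu>) < a"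
  then have pos: "0 < a - (\<integral>y. G y \<partial>\<nu>)" by simp
  have "\<forall>\<^sub>F n in sequentially. (\<integral>y. - G y \<partial>\<nu>) - (a - (\<integral>y. G y \<partial>\<nu>)) < (\<integral>y. - F n y \<partial>M n)"
  proof (rule integral_continuous_convergence_lower[OF prob sets carried nu weak _ _ _ _ _ pos])
    show "(\<lambda>y. - F n y) \<in> borel_measurable borel" for n
      using F_meas by (rule borel_measurable_uminus)
    show "(\<lambda>y. - G y) \<in> borel_measurable borel"
      using G_meas by (rule borel_measurable_uminus)
    show "\<bar>- F n y\<bar> \<le> C" for n y using F_bound by simp
    show "\<bar>- G y\<bar> \<le> C" for y using G_bound by simp
    show "(\<lambda>k. - F (s k) (y k)) \<longlonglongrightarrow> - G y0"
      if "strict_mono s" "\<And>k. y k \<in> S (s k)" "y \<longlonglongrightarrow> y0" for s y y0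
      using conv[OF that] by (rule tendsto_minus)
  qed
  then show "\<forall>\<^sub>F n in sequentially. (\<integral>y. F n y \<partial>M n) < a" by simp
qed

section \<open>Reversibility in the fluid limit\<close>

lemma measurable_path_eval: "(\<lambda>x. x t) \<in> path_space \<rightarrow>\<^sub>M borel" if "0 \<le> t"
  unfolding path_space_def
  using that by (intro measurable_restrict_space1 measurable_component_singleton) auto

text \<open>
  Slutsky's lemma for a constant limit. Near \<open>(y0, x0)\<close> the function \<open>h\<close> is almost constant; the
  probability of being away from \<open>x0\<close> is controlled by the expectation of a truncated
  multiple of the distance to \<open>x0\<close>, itself a bounded continuous function that vanishes at \<open>x0\<close>.
\<close>

lemma deterministic_limit_joint:
  fixes h :: "'a::metric_space \<times> 'a \<Rightarrow> real"
  assumes prob: "\<And>k. prob_space (M k)" and sets: "\<And>k. sets (M k) = sets borel"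
    and lim: "\<And>f::'a \<Rightarrow> real. f \<in> bcontfun \<Longrightarrow> (\<lambda>k. \<integral>v. f v \<partial>M k) \<longlonglongrightarrow> f x0"
    and y: "y \<longlonglongrightarrow> y0" and h: "h \<in> bcontfun"
  shows "(\<lambda>k. \<integral>v. h (y k, v) \<partial>M k) \<longlonglongrightarrow> h (y0, x0)"
proof (rule tendstoI)
  fix e :: real assume e: "0 < e"
  have cont: "continuous_on UNIV h" and "bounded (range h)" using h unfolding bcontfun_def by auto
  then obtain C where C: "0 < C" "\<And>p. \<bar>h p\<bar> \<le> C"
    unfolding bounded_pos by auto
  have "isCont h (y0, x0)" using cont by (simp add: continuous_on_eq_continuous_at)
  then obtain d where d: "0 < d" "\<And>p. dist p (y0, x0) < d \<Longrightarrow> dist (h p) (h (y0, x0)) < e / 2"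
    unfolding continuous_at_eps_delta using e by (metis half_gt_zero)
  \<comment> \<open>The factor makes \<open>f\<close> equal to 1 outside the ball of radius \<open>d / 2\<close>; the other half
    of \<open>d\<close> is left for the distance from \<open>y k\<close> to \<open>y0\<close>.\<close>
  define f where "f v = min 1 (2 * dist v x0 / d)" for v
  have f_bcont: "f \<in> bcontfun"
    unfolding f_def[abs_def] using d(1)
    by (intro bcontfunI_abs[of _ 1] continuous_intros) (auto simp: abs_le_iff)
  have "f x0 = 0" unfolding f_def by simp
  then have "(\<lambda>k. \<integral>v. f v \<partial>M k) \<longlonglongrightarrow> 0" using lim[OF f_bcont] by simp
  then have "\<forall>\<^sub>F k in sequentially. (\<integral>v. f v \<partial>M k) < e / (4 * C)"
    using e C(1) by (intro order_tendstoD(2)) auto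
  moreover have "\<forall>\<^sub>F k in sequentially. dist (y k) y0 < d / 2"
    using y d(1) by (intro tendstoD) auto
  ultimately show "\<forall>\<^sub>F k in sequentially. dist (\<integral>v. h (y k, v) \<partial>M k) (h (y0, x0)) < e"
  proof eventually_elim
    case (elim k)
    interpret prob_space "M k" by (rule prob)
    have f_int: "integrable (M k) f"
      using prob sets f_bcont by (rule bounded_continuous_integrable)
    have "continuous_on UNIV (\<lambda>v. h (y k, v))"
      by (rule continuous_on_compose2[OF cont]) (auto intro!: continuous_intros)
    then have "(\<lambda>v. h (y k, v)) \<in> bcontfun" using C(2) by (rule bcontfunI_abs)
    then have h_int: "integrable (M k) (\<lambda>v. h (y k, v))"
      using prob sets by (intro bounded_continuous_integrable)
    have le: "\<bar>h (y k, v) - h (y0, x0)\<bar> \<le> e / 2 + 2 * C * f v" for v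
    proof (cases "dist v x0 < d / 2")
      case True
      have "dist (y k, v) (y0, x0) \<le> dist (y k) y0 + dist v x0"
        unfolding dist_Pair_Pair by (rule sqrt_sum_squares_le_sum) auto
      then have "dist (h (y k, v)) (h (y0, x0)) < e / 2"
        using True elim(2) by (intro d(2)) linarith
      moreover have "0 \<le> 2 * C * f v" using C(1) d(1) unfolding f_def by auto
      ultimately show ?thesis by (simp add: dist_real_def)
    next
      case False
      then have "f v = 1" using d(1) unfolding f_def by (simp add: field_simps)
      then show ?thesis using C(2)[of "(y k, v)"] C(2)[of "(y0, x0)"] e by auto
    qed
    have "(\<integral>v. h (y k, v) \<partial>M k) - h (y0, x0) = (\<integral>v. h (y k, v) - h (y0, x0) \<partial>M k)"
      using h_int by (simp add: prob_space)
    then have "\<bar>(\<integral>v. h (y k, v) \<partial>M k) - h (y0, x0)\<bar> \<le> (\<integral>v. \<bar>h (y k, v) - h (y0, x0)\<bar> \<partial>M k)"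
      using integral_abs_bound by metis
    also have "\<dots> \<le> (\<integral>v. e / 2 + 2 * C * f v \<partial>M k)"
      using h_int f_int le by (intro integral_mono) auto
    also have "\<dots> = e / 2 + 2 * C * (\<integral>v. f v \<partial>M k)"
      using f_int by (simp add: prob_space)
    also have "\<dots> < e" using elim(1) C(1) by (simp add: field_simps)
    finally show ?case by (simp add: dist_real_def)
  qed
qed


lemma prob_kernelD:
  assumes "K \<in> borel \<rightarrow>\<^sub>M prob_algebra N"
  shows "prob_space (K y)" and "sets (K y) = sets N"
  using measurable_space[OF assms, of y] by (auto simp: space_prob_algebra)

lemma path_law_eval:
  assumes K: "K \<in> borel \<rightarrow>\<^sub>M prob_algebra path_space" and t: "0 \<le> t"
  shows "(\<lambda>x. x t) \<in> K y \<rightarrow>\<^sub>M borel"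
  using measurable_path_eval[OF t] measurable_cong_sets[OF prob_kernelD(2)[OF K] refl] by blast

text \<open>
  The integrand depends on \<open>y\<close> as well as the measure does. Pushing \<open>K y\<close> forward to the law of
  \<open>(y, x t)\<close> moves both dependences into one kernel.
\<close>

lemma measurable_path_expectation:
  fixes h :: "'a::second_countable_topology \<times> 'a \<Rightarrow> real"
  assumes K: "K \<in> borel \<rightarrow>\<^sub>M prob_algebra path_space" and t: "0 \<le> t"
    and h: "h \<in> bcontfun"
  shows "(\<lambda>y. \<integral>x. h (y, x t) \<partial>K y) \<in> borel_measurable borel"
proof -
  have h_meas: "h \<in> borel_measurable (borel \<Otimes>\<^sub>M borel)"
    using h borel_measurable_continuous_onI unfolding bcontfun_def borel_prod by auto
  note [measurable] = measurable_path_eval[OF t]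
  have "(\<lambda>y. distr (K y) (borel \<Otimes>\<^sub>M borel) (\<lambda>x. (y, x t)))
      \<in> borel \<rightarrow>\<^sub>M subprob_algebra (borel \<Otimes>\<^sub>M borel)"
    by (rule measurable_distr2[OF _ measurable_prob_algebraD[OF K]]) measurable
  from measurable_compose[OF this integral_measurable_subprob_algebra[OF h_meas]]
  show ?thesis
    using path_law_eval[OF K t] h_meas by (simp add: integral_distr)
qed

lemma abs_expectation_le:
  fixes f :: "'b \<Rightarrow> real"
  assumes "prob_space M" and "\<And>x. \<bar>f x\<bar> \<le> C"
  shows "\<bar>\<integral>x. f x \<partial>M\<bar> \<le> C"
proof -
  interpret prob_space M by fact
  have "0 \<le> C" using assms(2)[of undefined] by linarith
  then show ?thesis
  proof (cases "integrable M f")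
    case True
    have "\<bar>\<integral>x. f x \<partial>M\<bar> \<le> (\<integral>x. \<bar>f x\<bar> \<partial>M)" by (rule integral_abs_bound)
    also have "\<dots> \<le> (\<integral>x. C \<partial>M)" using True assms(2) by (intro integral_mono) auto
    finally show ?thesis by (simp add: prob_space)
  qed (simp add: not_integrable_integral_eq)
qed

text \<open>
  The joint law of the initial state, distributed as \<open>M n\<close>, and the state at time \<open>t\<close> converges
  weakly to the joint law of \<open>y\<close> and \<open>\<phi> t y\<close> under \<open>\<nu>\<close>. Reversibility compares this joint law
  with its mirror image.
\<close>

lemma fluid_limit_joint_expectation:
  fixes h :: "'a::polish_space \<times> 'a \<Rightarrow> real"
  assumes K: "\<And>n. K n \<in> borel \<rightarrow>\<^sub>M prob_algebra path_space"
    and prob: "\<And>n. prob_space (M n)" and sets: "\<And>n. sets (M n) = sets borel"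
    and carried: "\<And>n. AE y in M n. y \<in> S n"
    and nu: "prob_space \<nu>" "sets \<nu> = sets borel" and weak: "weakly_converges M \<nu>"
    and t: "0 \<le> t" and cont: "continuous_on UNIV (\<phi> t)"
    and fluid: "\<And>s y y0 f. strict_mono s \<Longrightarrow> (\<And>k. y k \<in> S (s k)) \<Longrightarrow> y \<longlonglongrightarrow> y0 \<Longrightarrow>
      f \<in> bcontfun \<Longrightarrow> (\<lambda>k. \<integral>x. f (x t) \<partial>K (s k) (y k)) \<longlonglongrightarrow> (f (\<phi> t y0) :: real)"
    and h: "h \<in> bcontfun"
  shows "(\<lambda>n. \<integral>y. (\<integral>x. h (y, x t) \<partial>K n y) \<partial>M n) \<longlonglongrightarrow> (\<integral>y. h (y, \<phi> t y) \<partial>\<nu>)"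
proof -
  have h_cont: "continuous_on UNIV h" and "bounded (range h)"
    using h unfolding bcontfun_def by auto
  then obtain C where C: "\<And>p. \<bar>h p\<bar> \<le> C" unfolding bounded_iff by auto
  show ?thesis
  proof (rule integral_continuous_convergence[OF prob sets carried nu weak])
    show "(\<lambda>y. \<integral>x. h (y, x t) \<partial>K n y) \<in> borel_measurable borel" for n
      using K t h by (rule measurable_path_expectation)
    show "\<bar>\<integral>x. h (y, x t) \<partial>K n y\<bar> \<le> C" for n y
      using prob_kernelD(1)[OF K] C by (rule abs_expectation_le)
    show "(\<lambda>y. h (y, \<phi> t y)) \<in> borel_measurable borel"
      by (intro borel_measurable_continuous_onI continuous_on_compose2[OF h_cont]
          continuous_intros cont) auto
    show "\<bar>h (y, \<phi> t y)\<bar> \<le> C" for y by (rule C)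
    fix s y y0 assume s: "strict_mono s" and y: "\<And>k. y k \<in> S (s k)" "y \<longlonglongrightarrow> y0"
    let ?L = "\<lambda>k. distr (K (s k) (y k)) borel (\<lambda>x. x t)"
    have eval: "(\<lambda>x. x t) \<in> K n z \<rightarrow>\<^sub>M borel" for n z
      using K t by (rule path_law_eval)
    have expect: "(\<integral>v. f v \<partial>?L k) = (\<integral>x. f (x t) \<partial>K (s k) (y k))"
      if "continuous_on UNIV f" for f :: "'a \<Rightarrow> real" and k
      using eval borel_measurable_continuous_onI[OF that] by (rule integral_distr)
    have "(\<lambda>k. \<integral>v. h (y k, v) \<partial>?L k) \<longlonglongrightarrow> h (y0, \<phi> t y0)"
    proof (rule deterministic_limit_joint[OF _ _ _ y(2) h])
      show "prob_space (?L k)" for k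
        using prob_kernelD(1)[OF K] eval by (rule prob_space.prob_space_distr)
      show "(\<lambda>k. \<integral>v. f v \<partial>?L k) \<longlonglongrightarrow> f (\<phi> t y0)" if "f \<in> bcontfun" for f :: "'a \<Rightarrow> real"
        using fluid[OF s y that] that expect[of f] unfolding bcontfun_def by simp
    qed simp
    moreover have "continuous_on UNIV (\<lambda>v. h (z, v))" for z
      by (rule continuous_on_compose2[OF h_cont]) (auto intro!: continuous_intros)
    ultimately show "(\<lambda>k. \<integral>x. h (y k, x t) \<partial>K (s k) (y k)) \<longlonglongrightarrow> h (y0, \<phi> t y0)"
      by (simp add: expect)
  qed
qed

section \<open>A reversible semi-flow is stationary\<close>

text \<open>
  A deterministic motion that is symmetric under exchange of its end points returns: reversibility
  makes \<open>(y, \<phi> s y)\<close> distributed like \<open>(\<phi> s y, y)\<close>, and since the second entry of the former is the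
  image under \<open>\<phi> s\<close> of the first, so it is almost surely for the latter, i.e. \<open>\<phi> s (\<phi> s y) = y\<close>.
  Taking \<open>s = t / 2\<close> fixes \<open>y\<close> at time \<open>t\<close>.
\<close>

lemma semiflow_reversible_AE_fixed:
  fixes \<phi> :: "real \<Rightarrow> 'a::polish_space \<Rightarrow> 'a"
  assumes sf: "semiflow \<phi>" and sc: "space_continuous \<phi>"
    and nu: "prob_space \<nu>" "sets \<nu> = sets borel" and rev: "semiflow_reversible \<phi> \<nu>"
    and t: "0 \<le> t"
  shows "AE y in \<nu>. \<phi> t y = y"
proof -
  define s where "s = t / 2"
  have s: "0 \<le> s" "t = s + s" using t by (auto simp: s_def)
  have cont: "continuous_on UNIV (\<phi> s)" using sc s unfolding space_continuous_def by auto
  define h where "h p = min 1 (dist (\<phi> s (snd p)) (fst p))" for p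
  have h: "h \<in> bcontfun"
    unfolding h_def[abs_def]
    by (intro bcontfunI_abs[of _ 1] continuous_intros continuous_on_compose2[OF cont]) auto
  have "(\<integral>y. h (y, \<phi> s y) \<partial>\<nu>) = (\<integral>y. h (\<phi> s y, y) \<partial>\<nu>)"
    using rev s h unfolding semiflow_reversible_def by blast
  then have zero: "(\<integral>y. h (y, \<phi> s y) \<partial>\<nu>) = 0" by (simp add: h_def)
  have "(\<lambda>y. h (y, \<phi> s y)) \<in> bcontfun"
    unfolding h_def[abs_def]
    by (intro bcontfunI_abs[of _ 1])
      (auto intro!: continuous_intros cont continuous_on_compose2[OF cont])
  then have "integrable \<nu> (\<lambda>y. h (y, \<phi> s y))"
    using nu by (intro bounded_continuous_integrable)
  then have "AE y in \<nu>. h (y, \<phi> s y) = 0"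
    using zero by (subst (asm) integral_nonneg_eq_0_iff_AE) (auto simp: h_def)
  moreover have "\<phi> t y = \<phi> s (\<phi> s y)" for y
    using sf s unfolding semiflow_def by (metis comp_apply)
  ultimately show ?thesis
    by (elim eventually_mono) (simp add: h_def min_def split: if_splits)
qed

text \<open>
  If \<open>y\<close> is fixed at almost every time, then for each \<open>s \<ge> 0\<close> there is a time \<open>u\<close> with \<open>y\<close> fixed at
  both \<open>u\<close> and \<open>s + u\<close>, as Lebesgue measure is translation invariant. Hence
  \<open>\<phi> s y = \<phi> s (\<phi> u y) = \<phi> (s + u) y = y\<close>.
\<close>

lemma stationary_points_iff_AE:
  fixes \<phi> :: "real \<Rightarrow> 'a::topological_space \<Rightarrow> 'a"
  assumes sf: "semiflow \<phi>"
  shows "y \<in> stationary_points \<phi> \<longleftrightarrow> (AE t in restrict_space lborel {0..}. \<phi> t y = y)"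
proof
  assume "AE t in restrict_space lborel {0..}. \<phi> t y = y"
  then have ae: "AE t in lborel. 0 \<le> t \<longrightarrow> \<phi> t y = y"
    by (subst (asm) AE_restrict_space_iff) auto
  have "\<phi> s y = y" if s: "0 \<le> s" for s
  proof -
    have "AE t in distr lborel borel ((+) s). 0 \<le> t \<longrightarrow> \<phi> t y = y"
      using ae unfolding lborel_distr_plus .
    then have ae_shift: "AE t in lborel. 0 \<le> s + t \<longrightarrow> \<phi> (s + t) y = y"
      by (rule AE_distrD[rotated]) simp
    obtain u where "0 \<le> u" "\<phi> u y = y" "\<phi> (s + u) y = y"
    proof (rule ccontr)
      assume none: "\<not> thesis"
      have "AE t in lborel. t \<notin> {0..1::real}"
        using ae ae_shift by eventually_elim (use none that s in auto)
      then have "{0..1::real} \<in> null_sets lborel"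
        by (subst (asm) AE_iff_null_sets[symmetric]) auto
      then show False by (simp add: null_sets_def)
    qed
    then show ?thesis
      using sf s unfolding semiflow_def by (metis comp_apply)
  qed
  then show "y \<in> stationary_points \<phi>" unfolding stationary_points_def by blast
qed (auto simp: stationary_points_def space_restrict_space intro!: AE_I2)

text \<open>
  Fubini exchanges the two quantifiers "for almost every". The same description by almost every
  time shows that the set of stationary points, an uncountable intersection by definition, is
  a Borel set: it is where the measure of the time section of a product measurable set vanishes.
\<close>

lemma AE_stationary_of_AE_fixed:
  fixes \<phi> :: "real \<Rightarrow> 'a::polish_space \<Rightarrow> 'a"
  assumes sf: "semiflow \<phi>" and nu: "prob_space \<nu>" "sets \<nu> = sets borel"
    and fixed: "\<And>t. 0 \<le> t \<Longrightarrow> AE y in \<nu>. \<phi> t y = y"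
  shows "measure \<nu> (stationary_points \<phi>) = 1"
proof -
  let ?T = "restrict_space lborel {0::real..}"
  interpret nu: prob_space \<nu> by fact
  interpret T: sigma_finite_measure ?T
    by (rule sigma_finite_measure_restrict_space) (auto intro: sigma_finite_lborel)
  interpret pair_sigma_finite \<nu> ?T ..
  have sets_T: "sets ?T = sets (restrict_space borel {0..})"
    by (auto simp: sets_restrict_space)
  have "sets (?T \<Otimes>\<^sub>M \<nu>) = sets (restrict_space borel {0..} \<Otimes>\<^sub>M borel)"
    using sets_T nu(2) by (rule sets_pair_measure_cong)
  then have "(\<lambda>(t, y). \<phi> t y) \<in> ?T \<Otimes>\<^sub>M \<nu> \<rightarrow>\<^sub>M borel"
    using sf measurable_cong_sets unfolding semiflow_def by blast
  then have flow_meas: "(\<lambda>x. \<phi> (snd x) (fst x)) \<in> \<nu> \<Otimes>\<^sub>M ?T \<rightarrow>\<^sub>M borel"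
    using measurable_compose[OF measurable_pair_swap'] by (fastforce simp: case_prod_beta)
  have fst_meas: "fst \<in> \<nu> \<Otimes>\<^sub>M ?T \<rightarrow>\<^sub>M borel"
    by (rule measurable_compose[OF measurable_fst measurable_ident_sets[OF nu(2)]])
  have meas: "{x \<in> space (\<nu> \<Otimes>\<^sub>M ?T). \<phi> (snd x) (fst x) = fst x} \<in> sets (\<nu> \<Otimes>\<^sub>M ?T)"
    (is "?D \<in> _")
    using borel_measurable_eq[OF borel_measurable_dist[OF flow_meas fst_meas]
        borel_measurable_const[of 0]] by simp
  have "AE t in ?T. AE y in \<nu>. \<phi> t y = y"
    by (rule AE_I2) (use fixed in \<open>simp add: space_restrict_space\<close>)
  then have "AE y in \<nu>. AE t in ?T. \<phi> t y = y"
    using AE_commute[OF meas] by simp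
  then have ae: "AE y in \<nu>. y \<in> stationary_points \<phi>"
    by (simp add: stationary_points_iff_AE[OF sf])
  have "stationary_points \<phi>
      = {y \<in> space \<nu>. emeasure ?T (Pair y -` (space (\<nu> \<Otimes>\<^sub>M ?T) - ?D)) = 0}"
  proof (rule set_eqI)
    fix y
    have y: "y \<in> space \<nu>" using sets_eq_imp_space_eq[OF nu(2)] by simp
    have N: "Pair y -` (space (\<nu> \<Otimes>\<^sub>M ?T) - ?D) \<in> sets ?T"
      using meas by (intro sets_Pair1) auto
    have "{t \<in> space ?T. \<not> \<phi> t y = y} = Pair y -` (space (\<nu> \<Otimes>\<^sub>M ?T) - ?D)"
      using y by (auto simp: space_pair_measure)
    with N have "(AE t in ?T. \<phi> t y = y)
        \<longleftrightarrow> emeasure ?T (Pair y -` (space (\<nu> \<Otimes>\<^sub>M ?T) - ?D)) = 0"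
      by (rule AE_iff_measurable)
    then show "y \<in> stationary_points \<phi> \<longleftrightarrow>
        y \<in> {y \<in> space \<nu>. emeasure ?T (Pair y -` (space (\<nu> \<Otimes>\<^sub>M ?T) - ?D)) = 0}"
      using y by (simp add: stationary_points_iff_AE[OF sf])
  qed
  also have "\<dots> \<in> sets \<nu>"
  proof -
    have "(\<lambda>y. emeasure ?T (Pair y -` (space (\<nu> \<Otimes>\<^sub>M ?T) - ?D))) \<in> borel_measurable \<nu>"
      using meas by (intro T.measurable_emeasure_Pair) auto
    then show ?thesis by measurable
  qed
  finally have "stationary_points \<phi> \<in> sets \<nu>" .
  then show ?thesis using ae
    by (simp add: nu.AE_in_set_eq_1)
qed

theorem theorem2:
  fixes P :: "nat \<Rightarrow> 'w measure"
    and Y :: "nat \<Rightarrow> real \<Rightarrow> 'w \<Rightarrow> 'a::polish_space"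
    and \<kappa> :: "nat \<Rightarrow> 'a \<Rightarrow> (real \<Rightarrow> 'a) measure"
    and E :: "nat \<Rightarrow> 'a set"
    and \<mu> :: "nat \<Rightarrow> 'a measure"
    and \<nu> :: "'a measure"
    and \<phi> :: "real \<Rightarrow> 'a \<Rightarrow> 'a"
  assumes "\<And>N. N \<ge> 1 \<Longrightarrow> cadlag_process (P N) (Y N)"
    and "\<And>N. N \<ge> 1 \<Longrightarrow> initial_cond_law (P N) (Y N) (\<kappa> N)"
    and "\<And>N. N \<ge> 1 \<Longrightarrow> feller (\<kappa> N)"
    and "\<And>N. N \<ge> 1 \<Longrightarrow> E N = law_support (P N) (Y N 0)"
    and "\<And>N. N \<ge> 1 \<Longrightarrow> prob_space (\<mu> N) \<and> sets (\<mu> N) = sets borel \<and> measure (\<mu> N) (E N) = 1"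
    and "\<And>N. N \<ge> 1 \<Longrightarrow> process_reversible (\<kappa> N) (\<mu> N)"
    and "semiflow \<phi>" and "space_continuous \<phi>"
    and "fluid_limit \<kappa> E \<phi>"
    and "prob_space \<nu>" and "sets \<nu> = sets borel"
    and "weak_limit_point \<mu> \<nu>"
  shows "semiflow_reversible \<phi> \<nu> \<and> measure \<nu> (stationary_points \<phi>) = 1"
proof
  obtain r where r: "strict_mono r" "\<And>k. 1 \<le> r k" and weak: "weakly_converges (\<mu> \<circ> r) \<nu>"
    using assms(12) unfolding weak_limit_point_def by blast
  have K: "\<kappa> (r k) \<in> borel \<rightarrow>\<^sub>M prob_algebra path_space" for k
    using assms(2)[OF r(2)] unfolding initial_cond_law_def by blast
  have mu: "prob_space ((\<mu> \<circ> r) k)" "sets ((\<mu> \<circ> r) k) = sets borel"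
    "measure ((\<mu> \<circ> r) k) (E (r k)) = 1" for k
    using assms(5)[OF r(2)] by auto
  have carried: "AE y in (\<mu> \<circ> r) k. y \<in> E (r k)" for k
    using mu(3) by (rule prob_space.AE_prob_1[OF mu(1)])
  have fluid: "(\<lambda>k. \<integral>x. f (x t) \<partial>\<kappa> (r (s k)) (y k)) \<longlonglongrightarrow> f (\<phi> t y0)"
    if "0 \<le> t" "strict_mono s" "\<And>k. y k \<in> E (r (s k))" "y \<longlonglongrightarrow> y0" "f \<in> bcontfun"
    for s y y0 t and f :: "'a \<Rightarrow> real"
    using assms(9)[unfolded fluid_limit_def, rule_format, of "r \<circ> s" y y0 t f]
      strict_mono_o[OF r(1) that(2)] r(2) that by simp
  have joint: "(\<lambda>k. \<integral>y. (\<integral>x. h (y, x t) \<partial>\<kappa> (r k) y) \<partial>(\<mu> \<circ> r) k) \<longlonglongrightarrow> (\<integral>y. h (y, \<phi> t y) \<partial>\<nu>)"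
    if "0 \<le> t" and "h \<in> bcontfun" for t and h :: "'a \<times> 'a \<Rightarrow> real"
  proof (rule fluid_limit_joint_expectation[where K = "\<lambda>k. \<kappa> (r k)" and S = "\<lambda>k. E (r k)"])
    show "continuous_on UNIV (\<phi> t)"
      using assms(8) that(1) unfolding space_continuous_def by blast
  qed (fact K mu carried assms(10,11) weak that fluid[OF that(1)])+
  show rev: "semiflow_reversible \<phi> \<nu>"
    unfolding semiflow_reversible_def
  proof (intro allI impI ballI)
    fix t :: real and h :: "'a \<times> 'a \<Rightarrow> real" assume t: "0 \<le> t" and h: "h \<in> bcontfun"
    have "continuous_on UNIV (h \<circ> prod.swap)"
      using h continuous_on_swap[of UNIV] unfolding bcontfun_def
      by (intro continuous_on_compose) (auto intro: continuous_on_subset)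
    then have "h \<circ> prod.swap \<in> bcontfun"
      using h unfolding bcontfun_def bounded_iff by auto
    from joint[OF t this]
    have "(\<lambda>k. \<integral>y. (\<integral>x. h (x t, y) \<partial>\<kappa> (r k) y) \<partial>(\<mu> \<circ> r) k) \<longlonglongrightarrow> (\<integral>y. h (\<phi> t y, y) \<partial>\<nu>)"
      by simp
    moreover have "(\<integral>y. (\<integral>x. h (x t, y) \<partial>\<kappa> (r k) y) \<partial>(\<mu> \<circ> r) k)
        = (\<integral>y. (\<integral>x. h (y, x t) \<partial>\<kappa> (r k) y) \<partial>(\<mu> \<circ> r) k)" for k
      using assms(6)[OF r(2)[of k]] t h unfolding process_reversible_def by simp
    ultimately show "(\<integral>y. h (y, \<phi> t y) \<partial>\<nu>) = (\<integral>y. h (\<phi> t y, y) \<partial>\<nu>)"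
      using LIMSEQ_unique[OF joint[OF t h]] by simp
  qed
  show "measure \<nu> (stationary_points \<phi>) = 1"
    using assms(7,10,11)
  proof (rule AE_stationary_of_AE_fixed)
    show "AE y in \<nu>. \<phi> t y = y" if "0 \<le> t" for t
      using assms(7,8,10,11) rev that by (rule semiflow_reversible_AE_fixed)
  qed
qed

end
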